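(* Let $(X,d)$ be a compact metric space. Suppose there exists a map $f : X \to X$ that is continuous, one-to-one (not necessarily onto), and positively expansive. Then $X$ is finite.
   Context: A continuous map $f : X \to X$ of a compact metric space $X$ with metric $d$ is called positively expansive if and only if there exists $\epsilon > 0$ such that for all $x, y \in X$ with $x \neq y$, one has $d(f^k(x), f^k(y)) > \epsilon$ for some integer $k \geq 0$. Here exponentiation denotes repeated composition: $f^0$ is the identity, $f^2 = f \circ f$, etc. *)

theory Defs
  imports "HOL-Analysis.Analysis"
begin

(* Only the separation condition: continuity of f (which includes f ` X \<subseteq> X) and compactness
   of X under d are separate hypotheses wherever this predicate is used. *)
definition positively_expansive :: "'a set \<Rightarrow> ('a \<Rightarrow> 'a \<Rightarrow> real) \<Rightarrow> ('a \<Rightarrow> 'a) \<Rightarrow> bool" where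
  "positively_expansive X d f \<longleftrightarrow>
     (\<exists>\<epsilon>>0. \<forall>x\<in>X. \<forall>y\<in>X. x \<noteq> y \<longrightarrow> (\<exists>k::nat. d ((f ^^ k) x) ((f ^^ k) y) > \<epsilon>))"

end

theory Submission
  imports Defs
begin

text \<open>
  Let \<open>\<epsilon>\<close> be an expansivity constant. Expansivity and injectivity together say that two points whose
  forward orbits are \<open>\<epsilon>\<close>-close at all times \<open>\<ge> 1\<close> coincide, because their images do. By compactness
  a bounded stretch of time suffices for a weaker conclusion: there is \<open>n\<close> such that closeness at the
  times \<open>1, \<dots>, n\<close> forces closeness at time \<open>0\<close> (lemma \<open>close_at_previous_time\<close>). So closeness
  during any \<open>n\<close> consecutive times propagates backwards to the whole past
  (lemma \<open>close_throughout_past\<close>).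

  The space is a finite union of sets, any two points of which stay \<open>\<epsilon>\<close>-close for \<open>n\<close> units of time.
  If there were more points than such sets, then at every time \<open>m\<close> two of the points would lie in a
  common set, hence would have been \<open>\<epsilon>\<close>-close at all times before \<open>m\<close>. Some fixed pair occurs for
  infinitely many \<open>m\<close>, so it stays \<open>\<epsilon>\<close>-close forever, against expansivity.
\<close>

lemma continuous_map_funpow:
  assumes "continuous_map T T f"
  shows "continuous_map T T (f ^^ k)"
proof (induction k)
  case 0
  show ?case
    by (simp add: id_def)
next
  case (Suc k)
  then show ?case
    using continuous_map_compose[OF Suc assms] by (simp only: funpow.simps)
qed

context Metric_space
begin

text \<open>
  The pairs that are far apart at time \<open>0\<close> but close at the times \<open>1, \<dots>, n\<close> form a decreasing sequence
  of closed subsets of the compact square. A common point would be a pair of distinct points with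
  equal images, so one of these sets is empty. The inequality at time \<open>0\<close> is taken to be the
  non-strict \<open>\<ge>\<close> to make the sets closed.
\<close>

lemma close_at_previous_time:
  assumes compact: "compact_space mtopology"
    and cont: "continuous_map mtopology mtopology f"
    and inj: "inj_on f M"
    and "\<epsilon> > 0"
    and expansive: "\<And>x y. \<lbrakk>x \<in> M; y \<in> M; x \<noteq> y\<rbrakk> \<Longrightarrow> \<exists>k. d ((f ^^ k) x) ((f ^^ k) y) > \<epsilon>"
  obtains n where "\<And>x y. \<lbrakk>x \<in> M; y \<in> M; \<forall>i\<in>{1..n}. d ((f ^^ i) x) ((f ^^ i) y) \<le> \<epsilon>\<rbrakk> \<Longrightarrow> d x y \<le> \<epsilon>"
proof -
  let ?T = "prod_topology mtopology mtopology"
  define g where "g k p = d ((f ^^ k) (fst p)) ((f ^^ k) (snd p))" for k and p :: "'a \<times> 'a"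
  have g: "continuous_map ?T euclideanreal (g k)" for k
  proof -
    have "continuous_map ?T mtopology ((f ^^ k) \<circ> fst)" "continuous_map ?T mtopology ((f ^^ k) \<circ> snd)"
      using continuous_map_funpow[OF cont]
      by (rule continuous_map_compose[OF continuous_map_fst] continuous_map_compose[OF continuous_map_snd])+
    then show ?thesis
      using continuous_map_mdist[of ?T Self] by (simp add: g_def[abs_def] mtopology_of_def comp_def)
  qed
  define C where
    "C n = {p \<in> topspace ?T. g 0 p \<in> {\<epsilon>..}} \<inter> (\<Inter>i\<in>{1..n}. {p \<in> topspace ?T. g i p \<in> {..\<epsilon>}})" for n
  have closed: "closedin ?T {p \<in> topspace ?T. g k p \<in> S}" if "closed S" for k S
    using closedin_continuous_map_preimage[OF g, of S] that by simp
  have "closedin ?T (C n)" for n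
  proof -
    have "closedin ?T (topspace ?T \<inter> (\<Inter>i\<in>{1..n}. {p \<in> topspace ?T. g i p \<in> {..\<epsilon>}}))"
    proof (cases "n = 0")
      case True
      then show ?thesis
        by (simp only:) (simp del: topspace_prod_topology)
    next
      case False
      then show ?thesis
        by (intro closedin_Int closedin_topspace closedin_INT closed) auto
    qed
    then have "closedin ?T ({p \<in> topspace ?T. g 0 p \<in> {\<epsilon>..}} \<inter>
        (topspace ?T \<inter> (\<Inter>i\<in>{1..n}. {p \<in> topspace ?T. g i p \<in> {..\<epsilon>}})))"
      by (rule closedin_Int[OF closed[OF closed_atLeast]])
    also have "\<dots> = C n"
      unfolding C_def by blast
    finally show ?thesis .
  qed
  moreover have "decseq C"
    unfolding C_def decseq_def by fastforce
  moreover have "compact_space ?T"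
    using compact by (simp add: compact_space_prod_topology)
  moreover have "(\<Inter>n. C n) = {}"
  proof (rule ccontr)
    assume "(\<Inter>n. C n) \<noteq> {}"
    then obtain x y where xy: "\<And>n. (x, y) \<in> C n"
      by auto
    have M: "x \<in> M" "y \<in> M" and "d x y \<ge> \<epsilon>"
      using xy[of 0] by (auto simp: C_def g_def)
    have "d ((f ^^ k) (f x)) ((f ^^ k) (f y)) \<le> \<epsilon>" for k
      using xy[of "Suc k"] by (auto simp: C_def g_def funpow_swap1 dest!: bspec[of _ _ "Suc k"])
    moreover have "f x \<in> M" "f y \<in> M"
      using M cont by (auto simp: continuous_map_def)
    ultimately have "f x = f y"
      using expansive[of "f x" "f y"] by (meson not_less)
    then have "x = y"
      using inj M by (auto dest: inj_onD)
    with \<open>d x y \<ge> \<epsilon>\<close> \<open>\<epsilon> > 0\<close> M show False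
      by simp
  qed
  ultimately obtain n where n: "C n = {}"
    using compact_space_imp_nest[of ?T C] by blast
  have "d x y \<le> \<epsilon>" if "x \<in> M" "y \<in> M" "\<forall>i\<in>{1..n}. d ((f ^^ i) x) ((f ^^ i) y) \<le> \<epsilon>" for x y
  proof -
    have "(x, y) \<notin> C n"
      using n by simp
    then show ?thesis
      using that by (auto simp: C_def g_def)
  qed
  then show ?thesis
    by (rule that)
qed

text \<open>
  Downward induction on \<open>k\<close>, started at \<open>m\<close>: the one-step implication is applied to \<open>f\<^sup>k x\<close> and
  \<open>f\<^sup>k y\<close>, so the window of \<open>n\<close> close times moves back by one. The induction keeps closeness on the
  whole stretch from \<open>k\<close> to \<open>m + n - 1\<close>, from which each next window is taken.
\<close>

lemma close_throughout_past:
  assumes f: "f \<in> M \<rightarrow> M"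
    and step: "\<And>x y. \<lbrakk>x \<in> M; y \<in> M; \<forall>i\<in>{1..n}. d ((f ^^ i) x) ((f ^^ i) y) \<le> \<epsilon>\<rbrakk> \<Longrightarrow> d x y \<le> \<epsilon>"
    and M: "x \<in> M" "y \<in> M"
    and close: "\<forall>i<n. d ((f ^^ (m + i)) x) ((f ^^ (m + i)) y) \<le> \<epsilon>"
    and "k < m"
  shows "d ((f ^^ k) x) ((f ^^ k) y) \<le> \<epsilon>"
proof -
  have iter: "(f ^^ k) z \<in> M" if "z \<in> M" for z k
    using that f by (induction k) auto
  have "\<forall>i<m + n. k \<le> i \<longrightarrow> d ((f ^^ i) x) ((f ^^ i) y) \<le> \<epsilon>" if "k \<le> m" for k
    using that
  proof (induction k rule: inc_induct)
    case base
    show ?case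
      using close by (metis le_Suc_ex nat_add_left_cancel_less)
  next
    case (step k)
    have "d ((f ^^ i) ((f ^^ k) x)) ((f ^^ i) ((f ^^ k) y)) \<le> \<epsilon>" if "i \<in> {1..n}" for i
      using step.IH[rule_format, of "i + k"] step.hyps that by (simp add: funpow_add)
    then have "d ((f ^^ k) x) ((f ^^ k) y) \<le> \<epsilon>"
      using assms(2) iter M by blast
    with step.IH show ?case
      by (metis Suc_leI le_neq_implies_less)
  qed
  from this[of k] \<open>k < m\<close> show ?thesis
    by simp
qed

text \<open>
  The cover consists of \<open>\<epsilon>/2\<close>-balls for the metric that takes the maximal distance over the first
  \<open>n\<close> times. They are open because only finitely many iterates are involved.
\<close>

lemma finite_cover_close_orbits:
  assumes compact: "compact_space mtopology"
    and cont: "continuous_map mtopology mtopology f"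
    and "\<epsilon> > 0"
  obtains \<U> where "finite \<U>" "M \<subseteq> \<Union>\<U>"
    "\<And>U x y. \<lbrakk>U \<in> \<U>; x \<in> U; y \<in> U\<rbrakk> \<Longrightarrow> \<forall>i<n. d ((f ^^ i) x) ((f ^^ i) y) \<le> \<epsilon>"
proof -
  define B where
    "B x = M \<inter> (\<Inter>i<n. {u \<in> M. (f ^^ i) u \<in> mball ((f ^^ i) x) (\<epsilon> / 2)})" for x
  have iter: "(f ^^ k) z \<in> M" if "z \<in> M" for z k
    using continuous_map_funpow[OF cont, of k] that by (auto simp: continuous_map_def)
  have "openin mtopology {u \<in> M. (f ^^ i) u \<in> mball ((f ^^ i) x) (\<epsilon> / 2)}" for x i
    using openin_continuous_map_preimage[OF continuous_map_funpow[OF cont] openin_mball]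
    by (simp del: in_mball)
  then have "openin mtopology (B x)" for x
    unfolding B_def using openin_topspace[of mtopology]
    by (cases "n = 0") (auto intro!: openin_Int openin_INT2)
  moreover have "x \<in> B x" if "x \<in> M" for x
    using that iter \<open>\<epsilon> > 0\<close> by (simp add: B_def)
  then have "M \<subseteq> \<Union>(B ` M)"
    by blast
  ultimately obtain \<U> where \<U>: "finite \<U>" "\<U> \<subseteq> B ` M" "M \<subseteq> \<Union>\<U>"
    using compactinD[of mtopology "topspace mtopology" "B ` M"] compact
    by (auto simp: compact_space_def)
  have "d ((f ^^ i) x) ((f ^^ i) y) \<le> \<epsilon>" if "U \<in> \<U>" "x \<in> U" "y \<in> U" "i < n" for U x y i
  proof -
    obtain z where z: "z \<in> M" "U = B z"
      using \<U>(2) \<open>U \<in> \<U>\<close> by blast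
    have "(f ^^ i) x \<in> mball ((f ^^ i) z) (\<epsilon> / 2)" "(f ^^ i) y \<in> mball ((f ^^ i) z) (\<epsilon> / 2)"
      using that z by (auto simp: B_def)
    then show ?thesis
      using triangle''[of "(f ^^ i) x" "(f ^^ i) z" "(f ^^ i) y"] commute by fastforce
  qed
  then show ?thesis
    by (intro that[OF \<U>(1) \<U>(3)]) simp
qed

theorem finite_if_injective_positively_expansive:
  assumes compact: "compact_space mtopology"
    and cont: "continuous_map mtopology mtopology f"
    and inj: "inj_on f M"
    and "positively_expansive M d f"
  shows "finite M"
proof (rule ccontr)
  assume "infinite M"
  obtain \<epsilon> where "\<epsilon> > 0"
    and expansive: "\<And>x y. \<lbrakk>x \<in> M; y \<in> M; x \<noteq> y\<rbrakk> \<Longrightarrow> \<exists>k. d ((f ^^ k) x) ((f ^^ k) y) > \<epsilon>"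
    using assms(4) unfolding positively_expansive_def by blast
  obtain n where
    n: "\<And>x y. \<lbrakk>x \<in> M; y \<in> M; \<forall>i\<in>{1..n}. d ((f ^^ i) x) ((f ^^ i) y) \<le> \<epsilon>\<rbrakk> \<Longrightarrow> d x y \<le> \<epsilon>"
    using close_at_previous_time[OF compact cont inj \<open>\<epsilon> > 0\<close> expansive] by blast
  obtain \<U> where "finite \<U>" and cover: "M \<subseteq> \<Union>\<U>"
    and close: "\<And>U x y. \<lbrakk>U \<in> \<U>; x \<in> U; y \<in> U\<rbrakk> \<Longrightarrow> \<forall>i<n. d ((f ^^ i) x) ((f ^^ i) y) \<le> \<epsilon>"
    using finite_cover_close_orbits[OF compact cont \<open>\<epsilon> > 0\<close>, of n] by metis
  obtain S where S: "finite S" "card S = Suc (card \<U>)" "S \<subseteq> M"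
    using \<open>infinite M\<close> infinite_arbitrarily_large by blast
  have f: "f \<in> M \<rightarrow> M"
    using cont by (auto simp: continuous_map_def)
  have iter: "(f ^^ k) z \<in> M" if "z \<in> M" for z k
    using continuous_map_funpow[OF cont, of k] that by (auto simp: continuous_map_def)
  define P where "P = {(x, y) \<in> S \<times> S. x \<noteq> y}"
  have "\<exists>p\<in>P. \<forall>k<m. d ((f ^^ k) (fst p)) ((f ^^ k) (snd p)) \<le> \<epsilon>" for m
  proof -
    \<comment> \<open>The points are sorted by their position at time \<open>m\<close>; the bound \<open>card \<U>\<close> is the same for all \<open>m\<close>.\<close>
    have "\<exists>U\<in>\<U>. (f ^^ m) x \<in> U" if "x \<in> S" for x
      using cover iter that S(3) by blast
    then obtain u where u: "\<And>x. x \<in> S \<Longrightarrow> u x \<in> \<U> \<and> (f ^^ m) x \<in> u x"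
      by metis
    have "card (u ` S) < card S"
      using S(2) card_mono[OF \<open>finite \<U>\<close>, of "u ` S"] u by fastforce
    then have "\<not> inj_on u S"
      by (rule pigeonhole)
    then obtain x y where xy: "x \<in> S" "y \<in> S" "x \<noteq> y" "u x = u y"
      unfolding inj_on_def by blast
    have "\<forall>i<n. d ((f ^^ (m + i)) x) ((f ^^ (m + i)) y) \<le> \<epsilon>"
      using close[of "u x" "(f ^^ m) x" "(f ^^ m) y"] u[of x] u[of y] xy
      by (simp add: funpow_add add.commute[of m])
    then have "\<forall>k<m. d ((f ^^ k) x) ((f ^^ k) y) \<le> \<epsilon>"
      using close_throughout_past[OF f n] xy S(3) by blast
    with xy show ?thesis
      by (intro bexI[of _ "(x, y)"]) (auto simp: P_def)
  qed
  moreover have "finite P"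
    using finite_subset[of P "S \<times> S"] S(1) by (auto simp: P_def)
  ultimately obtain p where "p \<in> P"
    and often: "infinite {m \<in> UNIV. \<forall>k<m. d ((f ^^ k) (fst p)) ((f ^^ k) (snd p)) \<le> \<epsilon>}"
    using pigeonhole_infinite_rel[OF infinite_UNIV_nat, of P
        "\<lambda>m p. \<forall>k<m. d ((f ^^ k) (fst p)) ((f ^^ k) (snd p)) \<le> \<epsilon>"]
    by blast
  have p: "fst p \<in> M" "snd p \<in> M" "fst p \<noteq> snd p"
    using \<open>p \<in> P\<close> S(3) by (auto simp: P_def)
  have "d ((f ^^ k) (fst p)) ((f ^^ k) (snd p)) \<le> \<epsilon>" for k
    using often unfolding infinite_nat_iff_unbounded by blast
  with expansive[OF p] show False
    by (meson not_less)
qed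

end

theorem mainTheorem1:
  fixes X :: "'a set" and d :: "'a \<Rightarrow> 'a \<Rightarrow> real"
  assumes "Metric_space X d"
    and "compact_space (Metric_space.mtopology X d)"
    and "\<exists>f :: 'a \<Rightarrow> 'a.
           continuous_map (Metric_space.mtopology X d) (Metric_space.mtopology X d) f
           \<and> inj_on f X
           \<and> positively_expansive X d f"
  shows "finite X"
  using assms(3) Metric_space.finite_if_injective_positively_expansive[OF assms(1,2)] by auto

end
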